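(* The following identity holds: $$\sum_{n\geq 1} \left(\frac{-1}{2^{10}}\right)^n \frac{(1)_n^5}{(\frac12)_n^5} \left(\frac{351-1755 n+2240 n^2}{n^{10}}-\frac{\left(11 H_n^{(5)}-H_{2 n}^{(5)}\right) \left(205 n^2-160 n+32\right)}{n^5}\right) = -4\, \zeta(5,3)-\frac{\pi ^8}{4725}.$$
   Context: For a number $a$ and an integer $n\ge 0$, $(a)_n := a(a+1)\cdots(a+n-1)$ denotes the rising factorial (Pochhammer symbol), and $(a)_n^5$ means $((a)_n)^5$. For integers $N\ge 1$ and $s\ge 1$, $H_N^{(s)} := \sum_{j=1}^{N} j^{-s}$ is the generalized harmonic number. Multiple zeta values are defined by $$\zeta(s_1,\ldots,s_k) := \sum_{n_1 > \cdots > n_k \geq 1} \frac{1}{n_1^{s_1}\cdots n_k^{s_k}},$$ so that $\zeta(5,3)=\sum_{n_1>n_2\ge 1} \frac{1}{n_1^5 n_2^3}$. *)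

theory Defs
  imports "HOL-Analysis.Analysis"
begin

definition gen_harm :: "nat \<Rightarrow> nat \<Rightarrow> real" where
  "gen_harm s N = (\<Sum>j=1..N. 1 / real j ^ s)"

(* The index (s_1, ..., s_k) is a list, summed over the lists (n_1, ..., n_k) with
   n_1 > ... > n_k >= 1.  As usual for infsum, the value is 0 if the series diverges. *)
definition mzv :: "nat list \<Rightarrow> real" where
  "mzv ss = (\<Sum>\<^sub>\<infinity>ns | length ns = length ss \<and> sorted_wrt (>) ns \<and> (\<forall>n\<in>set ns. n \<ge> 1).
     \<Prod>i<length ss. 1 / real (ns ! i) ^ (ss ! i))"

end

theory Submission
  imports Defs
begin

text \<open>
  The factor \<open>(-1/2^10)^n (1)_n^5 / (1/2)_n^5\<close> equals \<open>(-1)^n / binom(2n,n)^5\<close>, so without the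
  harmonic numbers this is the Amdeberhan-Zeilberger series for \<open>-2 \<zeta>(3)\<close>, with numerator
  \<open>205 n^2 - 160 n + 32\<close>. The series of the theorem is a fifth-order derivative of a deformation
  of that one.

  Dougall's well-poised \<open>5F4\<close> sum comes with a WZ pair in five free parameters
  \<open>q_1, ..., q_5\<close>. Restricted to parameters of sum \<open>0\<close>, one boundary of this pair is a series in
  \<open>n\<close> with terms
  \<open>(-1)^(n-1) (\<Prod>i<j. \<Prod>l<n. l - q_i - q_j) / (\<Prod>i. \<Prod>l\<le>2n. l + q_i)\<close>
  times a polynomial, hence symmetric in the \<open>q_i\<close>; the other boundary is the well-poised series
  \<open>\<Sum>m. (m - q_5/2) \<Prod>j\<le>4. (\<Prod>l<m. l - q_5 - q_j) / (\<Prod>l\<le>m. l + q_j)\<close>, whose value at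
  \<open>q = 0\<close> is \<open>\<zeta>(3)\<close>. If \<open>e_1, ..., e_5\<close> are the elementary symmetric functions of the \<open>q_i\<close>, then
  the derivative with respect to \<open>e_5\<close> turns the products into fifth-order harmonic numbers:
  the pair products contribute \<open>11 H_n\<close>, because \<open>\<Sum>i<j. (q_i + q_j)^5 = -11 \<Sum>i. q_i^5\<close>
  when \<open>e_1, ..., e_4\<close> vanish, and the denominators contribute \<open>- H_2n\<close>.

  The obvious choice for isolating \<open>e_5\<close> is \<open>q_i = x \<omega>^i\<close> with \<open>\<omega>\<close> a fifth root of unity, but
  then the boundary in \<open>m\<close>, which is not visibly symmetric, has to be expanded to order \<open>5\<close> in
  \<open>x\<close>. By symmetry it is enough to take \<open>q_5 = t\<close> and \<open>\<Prod>j\<le>4. X + q_j = X^4 - t X^3 + f\<close> modulo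
  \<open>t^2\<close> and \<open>f^2\<close>: then \<open>e_1 = e_2 = e_3 = 0\<close>, \<open>e_4 = f\<close>, \<open>e_5 = t f\<close>, and the derivative is just the
  coefficient of \<open>t f\<close>. With this choice the boundary in \<open>m\<close> involves nothing worse than the
  double sums \<open>\<zeta>(3,5)\<close> and \<open>\<zeta>(7,1)\<close>: it equals
  \<open>2 \<zeta>(3,5) + 2 \<zeta>(7,1) - 3/2 \<zeta>(8)\<close>. The relation
  \<open>\<zeta>(3) \<zeta>(5) = \<zeta>(3,5) + \<zeta>(5,3) + \<zeta>(8)\<close> and Euler's evaluation
  \<open>\<zeta>(7,1) = 5/4 \<zeta>(8) - \<zeta>(3) \<zeta>(5)\<close> reduce it to \<open>- 2 \<zeta>(5,3) - \<zeta>(8)\<close>, half of the claimed value.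

  The weight is carried by \<open>wz_identity\<close> (the WZ pair over the ring of jets \<open>\<real>[t,f]/(t^2,f^2)\<close>),
  \<open>ctf_wz_step\<close> (its symmetric boundary), \<open>wz_step_sums\<close> (the passage to infinite series, coefficientwise,
  so that no derivative of an infinite series has to be justified), and \<open>euler_double_sum_7_1\<close>.
\<close>

section \<open>Jets: the ring of real polynomials in two nilpotent parameters\<close>

text \<open>
  \<open>Jet a b c d\<close> stands for \<open>a + b t + c f + d t f\<close> in \<open>\<real>[t,f]/(t^2,f^2)\<close>.
\<close>
datatype jet = Jet (c1: real) (ct: real) (cf: real) (ctf: real)

instantiation jet :: comm_ring_1
begin
definition "0 = Jet 0 0 0 0"
definition "1 = Jet 1 0 0 0"
definition "x + y = Jet (c1 x + c1 y) (ct x + ct y) (cf x + cf y) (ctf x + ctf y)"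
definition "x - y = Jet (c1 x - c1 y) (ct x - ct y) (cf x - cf y) (ctf x - ctf y)"
definition "- x = Jet (- c1 x) (- ct x) (- cf x) (- ctf x)"
definition "x * y = Jet (c1 x * c1 y) (c1 x * ct y + ct x * c1 y) (c1 x * cf y + cf x * c1 y)
   (c1 x * ctf y + ct x * cf y + cf x * ct y + ctf x * c1 y)"
instance
  by standard (auto simp: zero_jet_def one_jet_def plus_jet_def minus_jet_def uminus_jet_def
      times_jet_def algebra_simps intro: jet.expand)
end

lemmas jet_defs = zero_jet_def one_jet_def plus_jet_def minus_jet_def uminus_jet_def times_jet_def

lemma jet_sel [simp]:
  "c1 0 = 0" "ct 0 = 0" "cf 0 = 0" "ctf 0 = 0"
  "c1 1 = 1" "ct 1 = 0" "cf 1 = 0" "ctf 1 = 0"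
  "c1 (x + y) = c1 x + c1 y" "ct (x + y) = ct x + ct y" "cf (x + y) = cf x + cf y" "ctf (x + y) = ctf x + ctf y"
  "c1 (x - y) = c1 x - c1 y" "ct (x - y) = ct x - ct y" "cf (x - y) = cf x - cf y" "ctf (x - y) = ctf x - ctf y"
  "c1 (- x) = - c1 x" "ct (- x) = - ct x" "cf (- x) = - cf x" "ctf (- x) = - ctf x"
  "c1 (x * y) = c1 x * c1 y" "ct (x * y) = c1 x * ct y + ct x * c1 y" "cf (x * y) = c1 x * cf y + cf x * c1 y"
  "ctf (x * y) = c1 x * ctf y + ct x * cf y + cf x * ct y + ctf x * c1 y"
  by (simp_all add: jet_defs)

section \<open>The WZ pair\<close>

text \<open>
  Write \<open>P(x) = x^4 - t x^3 + f\<close> and let \<open>q_1, ..., q_4\<close> be the formal quantities with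
  \<open>P(x) = \<Prod>j. x + q_j\<close>; put \<open>q_5 = t\<close>. The four jets below are \<open>jetP x = P(x)\<close>,
  \<open>jetQ x = \<Prod>j\<le>4. x - q_5 - q_j = P(t - x)\<close>, \<open>jetS x = \<Prod>i<j\<le>4. x - q_i - q_j\<close> and
  \<open>jetL x = x + q_5\<close>. Their products are symmetric in all five \<open>q_i\<close>:
  \<open>L P = x^5 + f x + t f\<close> and \<open>S Q = x^10 - 3 f x^6 + 11 t f x^5\<close>.
\<close>
abbreviation lin :: "real \<Rightarrow> real \<Rightarrow> jet" where "lin a b \<equiv> Jet a b 0 0"
definition jetP :: "real \<Rightarrow> jet" where "jetP x = Jet (x^4) (-(x^3)) 1 0"
definition jetQ :: "real \<Rightarrow> jet" where "jetQ x = Jet (x^4) (-3*x^3) 1 0"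
definition jetS :: "real \<Rightarrow> jet" where "jetS x = Jet (x^6) (3*x^5) (-4*x^2) (-4*x)"
definition jetL :: "real \<Rightarrow> jet" where "jetL x = Jet x 1 0 0"

text \<open>
  The certificate. The reflection \<open>M \<mapsto> u + t - M\<close> exchanges \<open>P(M)\<close> and \<open>Q(M - u)\<close>, so a
  quadratic polynomial in \<open>M\<close> whose odd part is dictated by the first summand of
  \<open>wz_polynomial_identity\<close> leaves just two unknown coefficients. Comparing powers of \<open>M\<close> determines them;
  their common denominator \<open>8 L(2u-1) L(2u)\<close> is cleared here.
\<close>
definition wz_cert :: "real \<Rightarrow> real \<Rightarrow> jet" where
 "wz_cert u M = lin (2*u) 1 * lin (2*M-u) (-1) * lin (2*M-5*u) (-3) + lin (10*u^3) (15*u^2)"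

text \<open>
  The WZ equation after division by all common products, with \<open>u = n + 1\<close>.
\<close>
lemma wz_polynomial_identity:
  fixes u M :: real
  shows "jetL (2*u-1) * jetL (2*u) * jetQ (M-u) * lin (M-(u-1)/2) (-1/2) + jetS u * lin (M-u/2) (-1/2)
     = (jetP M * wz_cert u M - jetQ (M-u) * wz_cert u (M+1)) * lin (1/8) 0"
  by (rule jet.expand, simp add: jetP_def jetQ_def jetS_def jetL_def wz_cert_def, intro conjI)
     algebra+

text \<open>
  What remains of the boundary term of the WZ pair along \<open>m = 2n + 1\<close> once the common products are
  removed, again with \<open>u = n + 1\<close>. Being symmetric in the \<open>q_i\<close>, it depends on \<open>f\<close> and \<open>t f\<close> only, so
  that its coefficient of \<open>t\<close> vanishes.
\<close>
definition step_poly :: "real \<Rightarrow> jet" where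
  "step_poly u =
     jetL (2*u-1) * jetL (2*u) * (jetP (2*u) * lin ((3*u-1)/2) (-1/2) + jetQ u * lin ((3*u+1)/2) (-1/2))
     + jetQ u * wz_cert u (2*u+1) * lin (1/8) 0"

lemma step_poly:
  "c1 (step_poly u) = u^5 * (205*u^2-160*u+32) / 2" "ct (step_poly u) = 0" "ctf (step_poly u) = (15*u^2-5*u+1)/2"
  unfolding step_poly_def jet_sel
  by (simp_all add: jetP_def jetQ_def jetS_def jetL_def wz_cert_def field_simps eval_nat_numeral)

text \<open>
  \<open>jexp r a b c\<close> is \<open>r exp(a t + b f + c t f)\<close>. In this form quotients of products of jets are
  obtained by adding the logarithmic coefficients, and these are harmonic numbers.
\<close>
definition jexp :: "real \<Rightarrow> real \<Rightarrow> real \<Rightarrow> real \<Rightarrow> jet" where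
  "jexp r a b c = Jet r (r * a) (r * b) (r * (c + a * b))"

lemma jexp_mult: "jexp r a b c * jexp r' a' b' c' = jexp (r * r') (a + a') (b + b') (c + c')"
  by (rule jet.expand) (simp add: jexp_def algebra_simps)

lemma jet_factor_jexp:
  assumes "x \<noteq> 0"
  shows "jetP x = jexp (x^4) (-1/x) (1/x^4) (1/x^5)"
    and "jetQ x = jexp (x^4) (-3/x) (1/x^4) (3/x^5)"
    and "- jetS x = jexp (-(x^6)) (3/x) (-4/x^4) (8/x^5)"
    and "jetL x = jexp x (1/x) 0 0"
  using assms by (auto intro!: jet.expand simp: jetP_def jetQ_def jetS_def jetL_def jexp_def field_simps eval_nat_numeral)

text \<open>
  The jet
  \<open>(-1)^n (\<Prod>l\<le>n. S(l)) (\<Prod>l\<le>i. Q(l)) / ((\<Prod>l\<le>d. L(l)) (\<Prod>l\<le>m. P(l)))\<close>,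
  written out with the logarithmic coefficients of \<open>jet_factor_jexp\<close>.
\<close>
definition gamma_block :: "nat \<Rightarrow> nat \<Rightarrow> nat \<Rightarrow> nat \<Rightarrow> jet" where
  "gamma_block n d i m = jexp ((-1)^n * fact n ^ 6 * fact i ^ 4 / (fact d * fact m ^ 4))
     (3 * gen_harm 1 n - gen_harm 1 d - 3 * gen_harm 1 i + gen_harm 1 m)
     (- 4 * gen_harm 4 n + gen_harm 4 i - gen_harm 4 m)
     (8 * gen_harm 5 n + 3 * gen_harm 5 i - gen_harm 5 m)"

lemma gen_harm_0 [simp]: "gen_harm s 0 = 0" by (simp add: gen_harm_def)
lemma gen_harm_Suc: "gen_harm s (Suc n) = gen_harm s n + 1 / real (Suc n) ^ s"
  by (simp add: gen_harm_def)

lemma arg_cong4: "a = a' \<Longrightarrow> b = b' \<Longrightarrow> c = c' \<Longrightarrow> d = d' \<Longrightarrow> f a b c d = f a' b' c' d'" by simp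

lemma gamma_block_Suc_n: "gamma_block (Suc n) d i m = gamma_block n d i m * (- jetS (real (Suc n)))"
  unfolding gamma_block_def jet_factor_jexp[OF of_nat_neq_0] jexp_mult
  by (intro arg_cong4[where f=jexp]) (simp_all add: gen_harm_Suc field_simps power_mult_distrib del: of_nat_Suc)

lemma gamma_block_Suc_d: "gamma_block n d i m = gamma_block n (Suc d) i m * jetL (real (Suc d))"
  unfolding gamma_block_def jet_factor_jexp[OF of_nat_neq_0] jexp_mult
  by (intro arg_cong4[where f=jexp]) (simp_all add: gen_harm_Suc field_simps power_mult_distrib del: of_nat_Suc)

lemma gamma_block_Suc_i: "gamma_block n d (Suc i) m = gamma_block n d i m * jetQ (real (Suc i))"
  unfolding gamma_block_def jet_factor_jexp[OF of_nat_neq_0] jexp_mult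
  by (intro arg_cong4[where f=jexp]) (simp_all add: gen_harm_Suc field_simps power_mult_distrib del: of_nat_Suc)

lemma gamma_block_Suc_m: "gamma_block n d i m = gamma_block n d i (Suc m) * jetP (real (Suc m))"
  unfolding gamma_block_def jet_factor_jexp[OF of_nat_neq_0] jexp_mult
  by (intro arg_cong4[where f=jexp]) (simp_all add: gen_harm_Suc field_simps power_mult_distrib del: of_nat_Suc)

text \<open>
  At \<open>n = 0\<close> this is the term of the well-poised series. Raising \<open>n\<close> by one replaces \<open>q_i\<close> by
  \<open>q_i + 2\<close> for all \<open>i\<close>; the index \<open>m\<close> is shifted by \<open>2n\<close> at the same time, so that the denominators
  \<open>P(1) ... P(m)\<close> do not change and the certificate has low degree. The summation range for a given \<open>n\<close> is therefore \<open>m \<ge> 2n + 1\<close>.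
\<close>
definition wz_F :: "nat \<Rightarrow> nat \<Rightarrow> jet" where
  "wz_F n m = gamma_block n (2*n) (m - n - 1) m * lin (real m - real n / 2) (-1/2)"
definition wz_G :: "nat \<Rightarrow> nat \<Rightarrow> jet" where
  "wz_G n m = gamma_block n (2*n+2) (m - n - 2) (m - 1) * wz_cert (real (Suc n)) (real m) * lin (1/8) 0"

lemma wz_identity:
  assumes "m \<ge> n + 2"
  shows "wz_F n m - wz_F (Suc n) m = wz_G n m - wz_G n (Suc m)"
proof -
  define j where "j = m - n - 2"
  have m: "m = Suc (Suc (n + j))" using assms by (simp add: j_def)
  define V where "V = gamma_block n (2*n+2) j m"
  define u where "u = real (Suc n)"
  have ind: "m - n - 1 = Suc j" "m - Suc n - 1 = j" "m - n - 2 = j" "m - 1 = Suc (n+j)"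
    "Suc m - n - 2 = Suc j" "Suc m - 1 = m" by (auto simp: m)
  have r: "real (Suc j) = real m - u" "real (Suc (2*n)) = 2*u-1" "real (Suc (Suc (2*n))) = 2*u"
     "real n / 2 = (u-1)/2" "real (Suc n)/2 = u/2"
    by (auto simp: m u_def)
  have F: "wz_F n m = V * (jetL (2*u-1) * jetL (2*u) * jetQ (real m-u) * lin (real m-(u-1)/2) (-1/2))"
    unfolding wz_F_def ind gamma_block_Suc_i unfolding r V_def gamma_block_Suc_d[of n "2*n"] gamma_block_Suc_d[of n "Suc (2*n)"]
    by (simp add: r mult_ac del: of_nat_Suc)
  have F': "wz_F (Suc n) m = - (V * (jetS u * lin (real m - u/2) (-1/2)))"
    unfolding wz_F_def ind gamma_block_Suc_n r by (simp add: V_def u_def mult_ac del: of_nat_Suc)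
  have G: "wz_G n m = V * (jetP (real m) * wz_cert u (real m) * lin (1/8) 0)"
    unfolding wz_G_def ind unfolding gamma_block_Suc_m[of _ _ _ "Suc (n+j)"] V_def m
    by (simp add: u_def mult_ac del: of_nat_Suc)
  have G': "wz_G n (Suc m) = V * (jetQ (real m-u) * wz_cert u (real m+1) * lin (1/8) 0)"
    unfolding wz_G_def ind gamma_block_Suc_i r V_def by (simp add: u_def mult_ac add_ac)
  have "wz_F n m - wz_F (Suc n) m = V * (jetL (2*u-1) * jetL (2*u) * jetQ (real m-u) * lin (real m-(u-1)/2) (-1/2) + jetS u * lin (real m-u/2) (-1/2))"
    unfolding F F' by (simp add: distrib_left)
  also have "\<dots> = wz_G n m - wz_G n (Suc m)"
    unfolding wz_polynomial_identity G G' by (simp add: algebra_simps)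
  finally show ?thesis .
qed

text \<open>
  The difference of the sums of \<open>wz_F n\<close> over \<open>m \<ge> 2n + 1\<close> and of \<open>wz_F (n + 1)\<close> over \<open>m \<ge> 2n + 3\<close>:
  the two terms by which the ranges differ, and the telescoped rest.
\<close>
definition wz_step :: "nat \<Rightarrow> jet" where "wz_step n = wz_F n (2*n+1) + wz_F n (2*n+2) + wz_G n (2*n+3)"

text \<open>
  The products in \<open>wz_F\<close> and \<open>wz_G\<close> combine here to products of \<open>S Q\<close> and of \<open>L P\<close>, whose
  logarithmic coefficients of \<open>t\<close> vanish. Hence only the logarithmic coefficient
  \<open>11 H_n - H_2n\<close> of \<open>t f\<close> and the coefficient of \<open>t f\<close> of the polynomial factor survive.
\<close>
lemma ctf_wz_step:
  fixes n defines "u \<equiv> real (Suc n)"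
  shows "ctf (wz_step n) = (-1)^n * (fact n ^ 10 / fact (2*n+2) ^ 5) *
    ((15*u^2-5*u+1)/2 + (11 * gen_harm 5 n - gen_harm 5 (2*n+2)) * (u^5 * (205*u^2-160*u+32) / 2))"
proof -
  define W where "W = gamma_block n (2*n+2) n (2*n+2)"
  have r: "real (Suc (2*n)) = 2*u-1" "real (Suc (Suc (2*n))) = 2*u"
    "real (2*n+1) - real n/2 = (3*u-1)/2" "real (2*n+2) - real n/2 = (3*u+1)/2" "real (2*n+3) = 2*u+1"
    by (auto simp: u_def field_simps)
  have r': "real (Suc (n*2)) = 2*u-1" "real (Suc (Suc (n*2))) = 2*u" by (auto simp: u_def)
  have ind: "2*n+1 - n - 1 = n" "2*n+2-n-1 = Suc n" "2*n+3-n-2 = Suc n" "2*n+3-1 = 2*n+2" by auto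
  have 1: "wz_F n (2*n+1) = W * (jetL (2*u-1) * jetL (2*u) * (jetP (2*u) * lin ((3*u-1)/2) (-1/2)))"
    unfolding wz_F_def ind r W_def using gamma_block_Suc_d[of n "2*n"] gamma_block_Suc_d[of n "Suc (2*n)"] gamma_block_Suc_m[of _ _ _ "2*n+1"]
    by (simp add: r r' mult_ac del: of_nat_Suc)
  have 2: "wz_F n (2*n+2) = W * (jetL (2*u-1) * jetL (2*u) * (jetQ u * lin ((3*u+1)/2) (-1/2)))"
    unfolding wz_F_def ind r W_def gamma_block_Suc_i using gamma_block_Suc_d[of n "2*n"] gamma_block_Suc_d[of n "Suc (2*n)"]
    by (simp add: r u_def[symmetric] del: of_nat_Suc)
  have 3: "wz_G n (2*n+3) = W * (jetQ u * wz_cert u (2*u+1) * lin (1/8) 0)"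
    unfolding wz_G_def ind r W_def gamma_block_Suc_i by (simp add: u_def[symmetric] mult_ac del: of_nat_Suc)
  have h: "wz_step n = W * step_poly u"
    unfolding wz_step_def 1 2 3 step_poly_def by (simp only: algebra_simps)
  have W: "ct W = 0" "c1 W = (-1)^n * (fact n ^ 10 / fact (2*n+2) ^ 5)"
     "ctf W = c1 W * (11 * gen_harm 5 n - gen_harm 5 (2*n+2))"
    by (simp_all add: W_def gamma_block_def jexp_def flip: power_add) (simp_all add: field_simps eval_nat_numeral)
  have "ctf (wz_step n) = c1 W * ((15*u^2-5*u+1)/2 + (11 * gen_harm 5 n - gen_harm 5 (2*n+2)) * (u^5 * (205*u^2-160*u+32) / 2))"
    unfolding h jet_sel step_poly W(1,3) by (simp only: distrib_left mult_zero_left mult_zero_right add_0_right mult_ac)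
  thus ?thesis unfolding W(2) .
qed

section \<open>Summation of the WZ pair\<close>

lemma gen_harm_nonneg [simp]: "gen_harm s n \<ge> 0"
  by (simp add: gen_harm_def sum_nonneg)

lemma gen_harm_1_le: "gen_harm 1 n \<le> real n"
proof -
  have "gen_harm 1 n \<le> (\<Sum>j=1..n. 1)" unfolding gen_harm_def by (intro sum_mono) auto
  thus ?thesis by simp
qed

lemma gen_harm_le_2: assumes "s \<ge> 2" shows "gen_harm s n \<le> 2"
proof -
  have "gen_harm s n \<le> 2 - 1 / real n" if "n \<ge> 1" using that
  proof (induction n rule: dec_induct)
    case base show ?case by (simp add: gen_harm_def)
  next
    case (step n)
    have "1 / real (Suc n) ^ s \<le> 1 / real (Suc n) ^ 2"
      using assms by (intro divide_left_mono power_increasing mult_pos_pos) auto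
    also have "\<dots> \<le> 1 / real n - 1 / real (Suc n)"
    proof -
      have "1 / real (Suc n) ^ 2 \<le> 1 / (real n * real (Suc n))"
        using step by (intro divide_left_mono) (auto simp: power2_eq_square)
      also have "\<dots> = 1 / real n - 1 / real (Suc n)" using step by (simp add: field_simps)
      finally show ?thesis .
    qed
    finally show ?case using step unfolding gen_harm_Suc by linarith
  qed
  thus ?thesis by (cases "n = 0") (auto intro: order_trans)
qed

text \<open>
  The logarithmic coefficients of \<open>f\<close> and \<open>t f\<close> are bounded since \<open>\<Sum> 1/l^4\<close> and \<open>\<Sum> 1/l^5\<close>
  converge. The one of \<open>t\<close> grows like a logarithm, but the crude linear bound is good enough
  against the decay \<open>m^(-4)\<close> of the factorials.
\<close>
lemma gamma_block_bound:
  assumes "n \<le> M" "d \<le> M" "i \<le> M" "m \<le> M" "M \<ge> 1"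
  defines "r \<equiv> fact n ^ 6 * fact i ^ 4 / (fact d * fact m ^ 4 :: real)"
  shows "\<bar>cf (gamma_block n d i m)\<bar> \<le> 10 * r" "\<bar>ctf (gamma_block n d i m)\<bar> \<le> 102 * r * real M"
proof -
  define a where "a = 3 * gen_harm 1 n - gen_harm 1 d - 3 * gen_harm 1 i + gen_harm 1 m"
  define b where "b = - 4 * gen_harm 4 n + gen_harm 4 i - gen_harm 4 m"
  define c where "c = 8 * gen_harm 5 n + 3 * gen_harm 5 i - gen_harm 5 m"
  have a: "\<bar>a\<bar> \<le> 8 * real M" unfolding a_def abs_le_iff
    using gen_harm_1_le[of n] gen_harm_1_le[of d] gen_harm_1_le[of i] gen_harm_1_le[of m]
      gen_harm_nonneg[of 1 n] gen_harm_nonneg[of 1 d] gen_harm_nonneg[of 1 i] gen_harm_nonneg[of 1 m]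
      assms(1-4)[folded of_nat_le_iff[where 'a=real]] by linarith
  have b: "\<bar>b\<bar> \<le> 10" unfolding b_def abs_le_iff
    using gen_harm_le_2[of 4 n] gen_harm_le_2[of 4 i] gen_harm_le_2[of 4 m]
      gen_harm_nonneg[of 4 n] gen_harm_nonneg[of 4 i] gen_harm_nonneg[of 4 m] by linarith
  have c: "\<bar>c\<bar> \<le> 22" unfolding c_def abs_le_iff
    using gen_harm_le_2[of 5 n] gen_harm_le_2[of 5 i] gen_harm_le_2[of 5 m]
      gen_harm_nonneg[of 5 n] gen_harm_nonneg[of 5 i] gen_harm_nonneg[of 5 m] by linarith
  have r: "r \<ge> 0" by (simp add: r_def)
  have rr: "\<bar>(-1)^n * fact n ^ 6 * fact i ^ 4 / (fact d * fact m ^ 4)\<bar> = r"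
    by (simp add: r_def abs_mult)
  have "\<bar>cf (gamma_block n d i m)\<bar> = r * \<bar>b\<bar>"
    unfolding gamma_block_def jexp_def a_def[symmetric] b_def[symmetric] by (simp add: abs_mult r_def)
  also have "\<dots> \<le> r * 10" by (intro mult_left_mono b r)
  finally show "\<bar>cf (gamma_block n d i m)\<bar> \<le> 10 * r" by simp
  have "\<bar>ctf (gamma_block n d i m)\<bar> = r * \<bar>c + a * b\<bar>"
    unfolding gamma_block_def jexp_def a_def[symmetric] b_def[symmetric] c_def[symmetric] by (simp add: abs_mult r_def)
  also have "\<dots> \<le> r * (102 * real M)"
  proof (intro mult_left_mono r)
    have "\<bar>c + a * b\<bar> \<le> \<bar>c\<bar> + \<bar>a\<bar> * \<bar>b\<bar>" by (metis abs_mult abs_triangle_ineq)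
    also have "\<dots> \<le> 22 + (8 * real M) * 10" using a b c by (intro add_mono mult_mono) auto
    also have "\<dots> \<le> 102 * real M" using assms(5) by simp
    finally show "\<bar>c + a * b\<bar> \<le> 102 * real M" .
  qed
  finally show "\<bar>ctf (gamma_block n d i m)\<bar> \<le> 102 * r * real M" by (simp add: mult_ac)
qed

lemma fact_mult_le: "fact n * fact k \<le> (fact (n + k) :: real)"
proof -
  have "fact n * fact k * real (n + k choose n) = fact (n + k)"
    using binomial_fact_lemma[of n "n+k", THEN arg_cong[where f=real]] by simp
  moreover have "real (n + k choose n) \<ge> 1" using zero_less_binomial[of n "n+k"] by (simp add: Suc_le_eq)
  ultimately show ?thesis
    by (metis mult_left_mono mult.right_neutral fact_ge_zero mult_nonneg_nonneg)
qed

text \<open>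
  The binomial coefficient \<open>binom(n+i+1, n)\<close> is at least \<open>1\<close>, which yields the fourth power of
  \<open>n! (i+1)! \<le> (n+i+1)!\<close>; the remaining \<open>n!^2\<close> is absorbed by \<open>d!\<close>.
\<close>
lemma fact_ratio_bound:
  assumes "d \<ge> 2 * n"
  shows "fact n ^ 6 * fact i ^ 4 / (fact d * fact (n + i + 1) ^ 4) \<le> 1 / real (Suc i) ^ 4"
proof -
  have "(fact n * fact (Suc i)) ^ 4 \<le> (fact (n + Suc i) :: real) ^ 4"
    by (intro power_mono fact_mult_le) auto
  moreover have "fact n * fact n \<le> (fact d :: real)"
    using fact_mult_le[of n n] fact_mono[OF assms, where 'a=real] by (simp add: mult_2)
  ultimately have "(fact n * fact (Suc i)) ^ 4 * (fact n * fact n) \<le> (fact (n + Suc i)) ^ 4 * (fact d :: real)"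
    by (intro mult_mono) auto
  moreover have "(fact n * fact (Suc i)) ^ 4 * (fact n * fact n) = (fact n ^ 6 * fact i ^ 4 * real (Suc i) ^ 4 :: real)"
    by (simp add: power_mult_distrib eval_nat_numeral del: of_nat_Suc)
  ultimately show ?thesis
    by (simp add: divide_simps mult_ac del: of_nat_Suc fact_Suc)
qed

lemma wz_F_bound:
  assumes m: "m \<ge> 2 * n + 1"
  shows "\<bar>ctf (wz_F n m)\<bar> \<le> 1712 / real m ^ 2"
proof -
  define i where "i = m - n - 1"
  have mi: "m = n + i + 1" "n \<le> i" using m by (auto simp: i_def)
  define r where "r = fact n ^ 6 * fact i ^ 4 / (fact (2*n) * fact m ^ 4 :: real)"
  have r0: "r \<ge> 0" by (simp add: r_def)
  have "r \<le> 1 / real (Suc i) ^ 4" unfolding r_def mi(1) by (intro fact_ratio_bound) auto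
  also have "\<dots> \<le> 1 / (real m / 2) ^ 4"
    using mi by (intro divide_left_mono power_mono mult_pos_pos) auto
  finally have r: "r \<le> 16 / real m ^ 4" by (simp add: field_simps)
  have b: "\<bar>cf (gamma_block n (2*n) i m)\<bar> \<le> 10 * r" "\<bar>ctf (gamma_block n (2*n) i m)\<bar> \<le> 102 * r * real m"
    using gamma_block_bound[of n m "2*n" i m] m unfolding r_def by (auto simp: i_def)
  have "ctf (wz_F n m) = ctf (gamma_block n (2*n) i m) * (real m - real n / 2) - cf (gamma_block n (2*n) i m) / 2"
    by (simp add: wz_F_def i_def)
  also have "\<bar>\<dots>\<bar> \<le> \<bar>ctf (gamma_block n (2*n) i m)\<bar> * \<bar>real m - real n / 2\<bar> + \<bar>cf (gamma_block n (2*n) i m)\<bar> / 2"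
    by (metis abs_divide abs_mult abs_numeral abs_triangle_ineq4)
  also have "\<dots> \<le> (102 * r * real m) * real m + (10 * r) / 2"
    using b m by (intro add_mono mult_mono divide_right_mono) (auto simp: r0)
  also have "\<dots> \<le> 107 * r * real m ^ 2"
  proof -
    have "1 \<le> real m ^ 2" using m by simp
    hence "r * 1 \<le> r * real m ^ 2" using r0 by (intro mult_left_mono)
    thus ?thesis by (simp add: power2_eq_square algebra_simps)
  qed
  also have "\<dots> \<le> 107 * (16 / real m ^ 4) * real m ^ 2"
    using r by (intro mult_right_mono mult_left_mono) auto
  also have "\<dots> = 1712 / real m ^ 2" using m by (simp add: field_simps eval_nat_numeral)
  finally show ?thesis .
qed

lemma wz_G_bound:
  assumes m: "m \<ge> 2 * n + 3"
  shows "\<bar>ctf (wz_G n m)\<bar> \<le> 6400 * real (Suc n) / real m"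
proof -
  define i where "i = m - n - 2"
  define u where "u = real (Suc n)"
  have mi: "m - 1 = n + i + 1" "n < i" "m = n + i + 2" using m by (auto simp: i_def)
  define x where "x = real m"
  have ux: "2 * u \<le> x" "u \<ge> 1" "x \<ge> 1" using m by (auto simp: u_def x_def)
  define r where "r = fact n ^ 6 * fact i ^ 4 / (fact (2*n+2) * fact (m-1) ^ 4 :: real)"
  have r0: "r \<ge> 0" by (simp add: r_def)
  have "r \<le> 1 / real (Suc i) ^ 4" unfolding r_def mi(1) by (intro fact_ratio_bound) auto
  also have "\<dots> \<le> 1 / (x / 2) ^ 4"
    unfolding x_def using mi by (intro divide_left_mono power_mono mult_pos_pos) auto
  finally have r: "r \<le> 16 / x ^ 4" by (simp add: field_simps)
  define B where "B = gamma_block n (2*n+2) i (m-1)"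
  have b: "\<bar>cf B\<bar> \<le> 10 * r" "\<bar>ctf B\<bar> \<le> 102 * r * x"
    using gamma_block_bound[of n m "2*n+2" i "m-1"] m unfolding r_def B_def x_def by (auto simp: i_def)
  define g where "g = wz_cert u x"
  have g: "cf g = 0" "ctf g = 0" by (auto simp: g_def wz_cert_def)
  have "c1 g = 2*u*((2*x-u)*(2*x-5*u)) + 10*u^3" by (simp add: g_def wz_cert_def)
  also have "\<bar>\<dots>\<bar> \<le> 2*u*((2*x)*(3*x)) + 10*u*x^2"
  proof -
    have "\<bar>2*u*((2*x-u)*(2*x-5*u))\<bar> \<le> 2*u*((2*x)*(3*x))"
      unfolding abs_mult using ux by (intro mult_mono) auto
    moreover have "\<bar>10*u^3\<bar> \<le> 10*u*x^2"
    proof -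
      have "u^2 \<le> x^2" using ux by (intro power_mono) auto
      hence "u * u^2 \<le> u * x^2" using ux by (intro mult_left_mono) auto
      thus ?thesis using ux by (simp add: power3_eq_cube power2_eq_square)
    qed
    ultimately show ?thesis by linarith
  qed
  finally have g1: "\<bar>c1 g\<bar> \<le> 22 * u * x^2" by (simp add: power2_eq_square)
  have "ct g = (2*x-u)*(2*x-5*u) - 2*u*(2*x-5*u) - 3*(2*u*(2*x-u)) + 15*u^2"
    by (simp add: g_def wz_cert_def algebra_simps)
  also have "\<dots> = 4 * (x * x) - 28 * (u * x) + 36 * (u * u)" by (simp add: algebra_simps power2_eq_square)
  also have "\<bar>\<dots>\<bar> \<le> 4 * (x*x) + 28 * (x*x) + 36 * (x*x)"
  proof -
    have "u * x \<le> x * x" "u * u \<le> x * x" using ux by (auto intro!: mult_mono)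
    moreover have "u * x \<ge> 0" "u * u \<ge> 0" "x * x \<ge> 0" using ux by auto
    ultimately show ?thesis unfolding abs_le_iff by linarith
  qed
  finally have gt: "\<bar>ct g\<bar> \<le> 68 * x^2" by (simp add: power2_eq_square)
  have "ctf (wz_G n m) = (ctf B * c1 g + cf B * ct g) / 8"
  proof -
    have "wz_cert (real (Suc n)) (real m) = g" by (simp only: g_def u_def x_def)
    thus ?thesis unfolding wz_G_def by (simp add: B_def i_def g)
  qed
  also have "\<bar>\<dots>\<bar> \<le> (\<bar>ctf B\<bar> * \<bar>c1 g\<bar> + \<bar>cf B\<bar> * \<bar>ct g\<bar>) / 8"
    by (simp add: abs_mult[symmetric] abs_triangle_ineq divide_right_mono)
  also have "\<dots> \<le> ((102 * r * x) * (22 * u * x^2) + (10 * r) * (68 * x^2)) / 8"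
    using b g1 gt ux r0 by (intro divide_right_mono add_mono mult_mono) auto
  also have "\<dots> \<le> 400 * r * u * x^3"
  proof -
    define T where "T = r * u * x^3"
    have "r * x^2 * 1 \<le> r * x^2 * (u * x)"
      using ux r0 mult_mono[of 1 u 1 x] by (intro mult_left_mono) auto
    also have "\<dots> = T" by (simp add: T_def eval_nat_numeral)
    finally have 1: "r * x^2 \<le> T" by simp
    have 2: "(102 * r * x) * (22 * u * x^2) = 2244 * T" "(10 * r) * (68 * x^2) = 680 * (r * x^2)"
      "400 * r * u * x^3 = 400 * T"
      by (simp_all add: T_def eval_nat_numeral)
    have "T \<ge> 0" using r0 ux by (auto simp: T_def)
    moreover have "(2244 * T + 680 * R) / 8 \<le> 400 * T" if "0 \<le> T" "R \<le> T" for R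
      using that by (simp add: field_simps)
    ultimately show ?thesis unfolding 2 using 1 by blast
  qed
  also have "\<dots> \<le> 400 * (16 / x^4) * u * x^3"
    using r ux by (intro mult_right_mono mult_left_mono) auto
  also have "\<dots> = 6400 * u / x" using ux by (simp add: field_simps eval_nat_numeral)
  finally show ?thesis by (simp add: u_def x_def)
qed

lemma summable_inv_sq: "summable (\<lambda>j. 1 / real (j + k) ^ 2)"
proof -
  have "summable (\<lambda>j. 1 / real j ^ 2)" using inverse_power_summable[of 2, where 'a=real] by (simp add: inverse_eq_divide)
  thus ?thesis by (subst summable_iff_shift[of "\<lambda>j. 1 / real j ^ 2"])
qed

lemma summable_wz_F: 
  assumes "k \<ge> 2 * n + 1" shows "summable (\<lambda>j. ctf (wz_F n (j + k)))"
  by (rule summable_comparison_test'[OF summable_mult[OF summable_inv_sq[of k], of 1712], of 0])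
     (use wz_F_bound[of n] assms in \<open>auto simp del: of_nat_add of_nat_Suc\<close>)

text \<open>
  The bound on \<open>wz_F n m\<close> is uniform in \<open>n\<close>, so these sums are dominated by tails of \<open>\<Sum> 1/m^2\<close>.
\<close>
lemma wz_F_suminf_tendsto: "(\<lambda>n. \<Sum>j. ctf (wz_F n (j + (2*n+1)))) \<longlonglongrightarrow> 0"
proof (rule Lim_null_comparison)
  have lim: "(\<lambda>k. \<Sum>j. 1 / real (j + k) ^ 2) \<longlonglongrightarrow> 0"
    using suminf_exist_split2[OF summable_inv_sq[of 0]] by simp
  show "(\<lambda>n. 1712 * (\<Sum>j. 1 / real (j + (2*n+1)) ^ 2)) \<longlonglongrightarrow> 0"
    by (rule tendsto_mult_right_zero, rule LIMSEQ_subseq_LIMSEQ[OF lim, of "\<lambda>n. 2*n+1", unfolded o_def])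
       (auto simp: strict_mono_def)
  show "\<forall>\<^sub>F n in sequentially. norm (\<Sum>j. ctf (wz_F n (j + (2*n+1)))) \<le> 1712 * (\<Sum>j. 1 / real (j + (2*n+1)) ^ 2)"
  proof (intro always_eventually allI)
    fix n
    have "norm (\<Sum>j. ctf (wz_F n (j + (2*n+1)))) \<le> (\<Sum>j. 1712 * (1 / real (j + (2*n+1)) ^ 2))"
      using wz_F_bound[of n] summable_mult[OF summable_inv_sq[of "2*n+1"], of 1712]
      by (intro norm_suminf_le) (auto simp del: of_nat_add of_nat_Suc)
    thus "norm (\<Sum>j. ctf (wz_F n (j + (2*n+1)))) \<le> 1712 * (\<Sum>j. 1 / real (j + (2*n+1)) ^ 2)"
      by (subst (asm) suminf_mult[OF summable_inv_sq])
  qed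
qed

lemma wz_G_tendsto: "(\<lambda>j. ctf (wz_G n (j + (2*n+3)))) \<longlonglongrightarrow> 0"
proof (rule Lim_null_comparison)
  have "(\<lambda>m. 6400 * real (Suc n) / real m) \<longlonglongrightarrow> 0"
    by (intro tendsto_divide_0[OF tendsto_const] filterlim_at_top_imp_at_infinity filterlim_real_sequentially)
  thus "(\<lambda>j. 6400 * real (Suc n) / real (j + (2*n+3))) \<longlonglongrightarrow> 0"
    by (rule LIMSEQ_ignore_initial_segment)
  show "\<forall>\<^sub>F j in sequentially. norm (ctf (wz_G n (j + (2*n+3)))) \<le> 6400 * real (Suc n) / real (j + (2*n+3))"
    using wz_G_bound[of n] by (intro always_eventually) (auto simp del: of_nat_add of_nat_Suc)
qed

lemma remainder_step:
  "(\<Sum>j. ctf (wz_F n (j + (2*n+1)))) - (\<Sum>j. ctf (wz_F (Suc n) (j + (2*Suc n+1)))) = ctf (wz_step n)"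
proof -
  have "(\<lambda>j. ctf (wz_G n (j + (2*n+3))) - ctf (wz_G n (Suc j + (2*n+3)))) sums (ctf (wz_G n (0 + (2*n+3))) - 0)"
    by (rule telescope_sums'[OF wz_G_tendsto])
  moreover have "ctf (wz_G n (j + (2*n+3))) - ctf (wz_G n (Suc j + (2*n+3)))
      = ctf (wz_F n (j + (2*n+3))) - ctf (wz_F (Suc n) (j + (2*n+3)))" for j
    using wz_identity[of n "j + (2*n+3)", THEN arg_cong[where f=ctf]] by simp
  ultimately have "(\<lambda>j. ctf (wz_F n (j + (2*n+3))) - ctf (wz_F (Suc n) (j + (2*n+3)))) sums ctf (wz_G n (2*n+3))"
    by simp
  hence "(\<Sum>j. ctf (wz_F n (j + (2*n+3)))) - (\<Sum>j. ctf (wz_F (Suc n) (j + (2*n+3)))) = ctf (wz_G n (2*n+3))"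
    by (subst suminf_diff) (auto intro!: summable_wz_F simp: sums_iff)
  moreover have "(\<Sum>j. ctf (wz_F n (j + (2*n+1)))) = (\<Sum>j. ctf (wz_F n (j + (2*n+3)))) + (ctf (wz_F n (2*n+1)) + ctf (wz_F n (2*n+2)))"
    by (subst suminf_split_initial_segment[where k=2, OF summable_wz_F]) (auto simp: eval_nat_numeral)
  ultimately show ?thesis by (simp add: wz_step_def eval_nat_numeral)
qed

lemma wz_step_sums: "(\<lambda>n. ctf (wz_step n)) sums (\<Sum>j. ctf (wz_F 0 (j + 1)))"
proof -
  have "(\<lambda>n. (\<Sum>j. ctf (wz_F n (j + (2*n+1)))) - (\<Sum>j. ctf (wz_F (Suc n) (j + (2*Suc n+1))))) sums
    ((\<Sum>j. ctf (wz_F 0 (j + (2*0+1)))) - 0)"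
    by (rule telescope_sums'[OF wz_F_suminf_tendsto])
  thus ?thesis unfolding remainder_step by simp
qed

text \<open>
  At \<open>n = 0\<close> the logarithmic coefficient of \<open>f\<close> collapses to \<open>- 1/m^4\<close>. This is why no triple sums
  appear.
\<close>
lemma ctf_wz_F_0: "ctf (wz_F 0 (Suc n)) = (let x = real (Suc n) in
    2 * gen_harm 5 n / x^3 + 2 * gen_harm 1 n / x^7 - 3 / 2 / x^8)"
  by (simp add: wz_F_def gamma_block_def jexp_def gen_harm_Suc Let_def del: of_nat_Suc)
     (simp add: field_simps eval_nat_numeral del: of_nat_Suc)

section \<open>Zeta values and Euler double sums\<close>

definition zeta_nat :: "nat \<Rightarrow> real" where "zeta_nat s = (\<Sum>n. 1 / real (Suc n) ^ s)"

lemma gen_harm_lessThan: "gen_harm s N = (\<Sum>k<N. 1 / real (Suc k) ^ s)"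
  by (induction N) (simp_all add: gen_harm_Suc)

lemma zeta_nat_sums: assumes "s \<ge> 2" shows "(\<lambda>n. 1 / real (Suc n) ^ s) sums zeta_nat s"
proof -
  have "summable (\<lambda>n. 1 / real n ^ s)"
    using inverse_power_summable[OF assms, where 'a=real] by (simp add: inverse_eq_divide)
  hence "summable (\<lambda>n. 1 / real (Suc n) ^ s)" by (subst summable_Suc_iff)
  thus ?thesis unfolding zeta_nat_def by (rule summable_sums)
qed

lemma gen_harm_tendsto: "s \<ge> 2 \<Longrightarrow> gen_harm s \<longlonglongrightarrow> zeta_nat s"
  using zeta_nat_sums[of s] unfolding sums_def gen_harm_lessThan[abs_def] .

text \<open>
  Products of zeta values are expanded over the square \<open>{1..N} \<times> {1..N}\<close> without its diagonal.
  Off the diagonal, geometric sums such as \<open>\<Sum>k. i^(-k) j^(k-8)\<close> split into partial fractions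
  with denominators \<open>j - i\<close>, and the inner sum can be evaluated. Keeping \<open>N\<close> finite
  until the end avoids every question of absolute convergence.
\<close>
definition offdiag_sum :: "nat \<Rightarrow> (nat \<Rightarrow> nat \<Rightarrow> real) \<Rightarrow> real" where
  "offdiag_sum N f = (\<Sum>i=1..N. \<Sum>j=1..N. if i = j then 0 else f i j)"

lemma offdiag_sum_sym: "offdiag_sum N (\<lambda>i j. f i j + f j i) = 2 * offdiag_sum N f"
proof -
  have "offdiag_sum N (\<lambda>i j. f j i) = offdiag_sum N f"
    unfolding offdiag_sum_def by (subst sum.swap) (auto intro!: sum.cong)
  moreover have "offdiag_sum N (\<lambda>i j. f i j + f j i) = offdiag_sum N f + offdiag_sum N (\<lambda>i j. f j i)"
    unfolding offdiag_sum_def sum.distrib[symmetric] by (auto intro!: sum.cong)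
  ultimately show ?thesis by simp
qed

lemma offdiag_sum_cong: "(\<And>i j. i \<ge> 1 \<Longrightarrow> j \<ge> 1 \<Longrightarrow> i \<noteq> j \<Longrightarrow> f i j = g i j) \<Longrightarrow> offdiag_sum N f = offdiag_sum N g"
  unfolding offdiag_sum_def by (auto intro!: sum.cong)

lemma offdiag_sum_add: "offdiag_sum N (\<lambda>i j. f i j + g i j) = offdiag_sum N f + offdiag_sum N g"
  unfolding offdiag_sum_def sum.distrib[symmetric] by (auto intro!: sum.cong)

lemma offdiag_sum_prod: "offdiag_sum N (\<lambda>i j. 1 / (real i ^ a * real j ^ b)) = gen_harm a N * gen_harm b N - gen_harm (a + b) N"
proof -
  have "gen_harm a N * gen_harm b N = (\<Sum>i=1..N. \<Sum>j=1..N. 1 / (real i ^ a * real j ^ b))"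
    unfolding gen_harm_def sum_product by simp
  also have "\<dots> = (\<Sum>i=1..N. \<Sum>j=1..N. (if i = j then 0 else 1 / (real i ^ a * real j ^ b)) + (if i = j then 1 / real i ^ (a+b) else 0))"
    by (intro sum.cong) (auto simp: power_add)
  also have "\<dots> = offdiag_sum N (\<lambda>i j. 1 / (real i ^ a * real j ^ b)) + gen_harm (a + b) N"
    unfolding sum.distrib offdiag_sum_def gen_harm_def by (simp add: sum.delta)
  finally show ?thesis by simp
qed

lemma sum_inv_diff:
  assumes "1 \<le> i" "i \<le> N"
  shows "(\<Sum>j=1..N. if i = j then 0 else 1 / (real j - real i)) = gen_harm 1 (N - i) - gen_harm 1 (i - 1)"
  using assms(2)
proof (induction N rule: dec_induct)
  case base
  have "(\<Sum>j=1..i. if i = j then 0 else 1 / (real j - real i)) = (\<Sum>j=1..i-1. - (1 / real j))"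
    by (rule sum.reindex_bij_witness_not_neutral[where S'="{i}" and T'="{}" and i="\<lambda>j. i - j" and j="\<lambda>j. i - j"])
       (auto simp: of_nat_diff field_simps)
  thus ?case by (simp add: gen_harm_def sum_negf)
next
  case (step N)
  have "Suc N - i = Suc (N - i)" using step by simp
  thus ?case using step by (simp add: gen_harm_Suc of_nat_diff)
qed

lemma gen_harm_add: "gen_harm 1 (n + k) = gen_harm 1 n + (\<Sum>j=1..k. 1 / (real j + real n))"
  by (induction k) (simp_all add: gen_harm_Suc add_ac)

lemma sum_inv_add:
  assumes "1 \<le> i" "i \<le> N"
  shows "(\<Sum>j=1..N. if i = j then 0 else 1 / (real j + real i)) = gen_harm 1 (i + N) - gen_harm 1 i - 1 / (2 * real i)"
proof -
  have "(\<Sum>j=1..N. 1 / (real j + real i)) = (\<Sum>j=1..N. (if i = j then 0 else 1 / (real j + real i)) + (if i = j then 1 / (2 * real i) else 0))"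
    by (intro sum.cong) auto
  also have "\<dots> = (\<Sum>j=1..N. if i = j then 0 else 1 / (real j + real i)) + 1 / (2 * real i)"
    unfolding sum.distrib using assms by simp
  finally show ?thesis using gen_harm_add[of i N] by simp
qed

lemma gen_harm_gap: "gen_harm 1 (n + k) - gen_harm 1 n \<le> real k / real (Suc n)"
proof -
  have "(\<Sum>j=1..k. 1 / (real j + real n)) \<le> (\<Sum>j=1..k. 1 / real (Suc n))"
    by (intro sum_mono divide_left_mono) auto
  thus ?thesis unfolding gen_harm_add by simp
qed

lemma gen_harm_1_over_tendsto: "(\<lambda>N. gen_harm 1 N / real (Suc N)) \<longlonglongrightarrow> 0"
proof (rule Lim_null_comparison)
  have *: "gen_harm 1 (Suc m) \<le> 1 + ln (real (Suc m))" for m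
  proof -
    have "harm (Suc m) - ln (real (Suc m)) \<le> harm (Suc 0) - ln (real (Suc 0))"
      using decseqD[OF decseq_harm_diff_ln, of 0 m] by simp
    moreover have "harm n = gen_harm 1 n" for n
      unfolding harm_def gen_harm_def by (simp add: inverse_eq_divide)
    ultimately show ?thesis by (simp add: gen_harm_Suc)
  qed
  have "(\<lambda>N. 1 / real N + ln (real N) / real N) \<longlonglongrightarrow> 0 + 0"
    by (intro tendsto_add lim_1_over_n lim_ln_over_n)
  thus "(\<lambda>N. 1 / real N + ln (real N) / real N) \<longlonglongrightarrow> 0" by simp
  show "\<forall>\<^sub>F N in sequentially. norm (gen_harm 1 N / real (Suc N)) \<le> 1 / real N + ln (real N) / real N"
    using eventually_gt_at_top[of 0]
  proof eventually_elim
    case (elim N)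
    then obtain m where m: "N = Suc m" by (cases N) auto
    have "gen_harm 1 N / real (Suc N) \<le> gen_harm 1 N / real N"
      using elim by (intro divide_left_mono) auto
    also have "\<dots> \<le> (1 + ln (real N)) / real N"
      using *[of m] unfolding m by (intro divide_right_mono) auto
    finally show ?case by (simp add: add_divide_distrib)
  qed
qed

text \<open>
  Truncating the inner sums at \<open>N\<close> leaves errors \<open>e N i\<close> that are differences of harmonic numbers.
  After division by \<open>i^p\<close> they are dominated, up to a constant, by
  \<open>\<Sum>i. 1 / (i (N + 1 - i)) = 2 H_N / (N + 1)\<close>.
\<close>
lemma harmonic_gap_sum_tendsto:
  assumes "p \<ge> 2" and e: "\<And>i N. 1 \<le> i \<Longrightarrow> i \<le> N \<Longrightarrow> 0 \<le> e N i \<and> e N i \<le> c * real i / real (Suc (N - i))"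
  shows "(\<lambda>N. \<Sum>i=1..N. e N i / real i ^ p) \<longlonglongrightarrow> 0"
proof (rule Lim_null_comparison)
  show "(\<lambda>N. 2 * \<bar>c\<bar> * (gen_harm 1 N / real (Suc N))) \<longlonglongrightarrow> 0"
    by (rule tendsto_mult_right_zero[OF gen_harm_1_over_tendsto])
  show "\<forall>\<^sub>F N in sequentially. norm (\<Sum>i=1..N. e N i / real i ^ p) \<le> 2 * \<bar>c\<bar> * (gen_harm 1 N / real (Suc N))"
  proof (intro always_eventually allI)
    fix N
    have "norm (\<Sum>i=1..N. e N i / real i ^ p) \<le> (\<Sum>i=1..N. \<bar>c\<bar> / real (Suc N) * (1 / real i + 1 / real (N + 1 - i)))"
    proof (rule order_trans[OF norm_sum sum_mono])
      fix i assume i: "i \<in> {1..N}"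
      have "real i ^ 2 \<le> real i ^ p" using i assms(1) by (intro power_increasing) auto
      moreover have "e N i \<le> \<bar>c\<bar> * real i / real (Suc (N - i))"
        using e[of i N] i by (auto intro!: order_trans[OF conjunct2[OF e]] divide_right_mono mult_right_mono)
      ultimately have "e N i / real i ^ p \<le> (\<bar>c\<bar> * real i / real (Suc (N - i))) / real i ^ 2"
        using i by (intro frac_le) auto
      also have "\<dots> = \<bar>c\<bar> / real (Suc N) * (1 / real i + 1 / real (N + 1 - i))"
      proof -
        have "real (Suc N) = real i + real (Suc (N - i))" "N + 1 - i = Suc (N - i)" using i by auto
        moreover have "C * a / b / a ^ 2 = C / (a + b) * (1 / a + 1 / b)" if "a > 0" "b > 0" for C a b :: real
        proof -
          have "1 / a + 1 / b = (a + b) / (a * b)" "a + b \<noteq> 0" using that by (auto simp: field_simps)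
          thus ?thesis by (simp add: power2_eq_square)
        qed
        ultimately show ?thesis using i by (simp del: of_nat_Suc)
      qed
      finally show "norm (e N i / real i ^ p) \<le> \<bar>c\<bar> / real (Suc N) * (1 / real i + 1 / real (N + 1 - i))"
        using e[of i N] i by simp
    qed
    also have "\<dots> = \<bar>c\<bar> / real (Suc N) * (gen_harm 1 N + (\<Sum>i=1..N. 1 / real (N + 1 - i)))"
      unfolding gen_harm_def by (simp add: sum_distrib_left sum.distrib distrib_left)
    also have "(\<Sum>i=1..N. 1 / real (N + 1 - i)) = gen_harm 1 N"
      unfolding gen_harm_def using sum.atLeastAtMost_rev[of "\<lambda>i. 1 / real i ^ 1" 1 N] by simp
    finally show "norm (\<Sum>i=1..N. e N i / real i ^ p) \<le> 2 * \<bar>c\<bar> * (gen_harm 1 N / real (Suc N))"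
      by (simp add: mult_ac)
  qed
qed

text \<open>
  For fixed \<open>i\<close>, \<open>\<Sum>j\<noteq>i. 1 / (j^2 - i^2) = 3 / (4 i^2)\<close> when \<open>j\<close> runs over all positive integers.
\<close>
lemma offdiag_sum_even_tendsto:
  assumes "p \<ge> 2"
  shows "(\<lambda>N. offdiag_sum N (\<lambda>i j. 1 / (real i ^ p * (real j ^ 2 - real i ^ 2)))) \<longlonglongrightarrow> 3 / 4 * zeta_nat (p + 2)"
proof -
  define e where "e N i = gen_harm 1 (i + N) - gen_harm 1 (N - i)" for N i
  have e: "0 \<le> e N i \<and> e N i \<le> 2 * real i / real (Suc (N - i))" if "i \<le> N" for i N
  proof -
    have "i + N = (N - i) + 2 * i" using that by simp
    thus ?thesis unfolding e_def using gen_harm_gap[of "N - i" "2 * i"] gen_harm_add[of "N - i" "2 * i"]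
      by (auto intro!: sum_nonneg)
  qed
  have eq: "offdiag_sum N (\<lambda>i j. 1 / (real i ^ p * (real j ^ 2 - real i ^ 2)))
      = 3 / 4 * gen_harm (p + 2) N - 1 / 2 * (\<Sum>i=1..N. e N i / real i ^ (p + 1))" for N
  proof -
    have "(\<Sum>j=1..N. if i = j then 0 else 1 / (real i ^ p * (real j ^ 2 - real i ^ 2)))
      = 3 / 4 * (1 / real i ^ (p+2)) - 1 / 2 * (e N i / real i ^ (p + 1))" if i: "i \<in> {1..N}" for i
    proof -
      have "(\<Sum>j=1..N. if i = j then 0 else 1 / (real i ^ p * (real j ^ 2 - real i ^ 2)))
         = (\<Sum>j=1..N. 1 / (2 * real i ^ (p+1)) * ((if i = j then 0 else 1 / (real j - real i)) - (if i = j then 0 else 1 / (real j + real i))))"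
      proof (intro sum.cong refl)
        fix j assume j: "j \<in> {1..N}"
        have sq: "real j ^ 2 - real i ^ 2 = (real j - real i) * (real j + real i)"
          by (simp add: algebra_simps power2_eq_square)
        have "1 / (real j - real i) - 1 / (real j + real i) = 2 * real i / ((real j - real i) * (real j + real i))"
          if "i \<noteq> j" using that i by (simp add: divide_simps)
        thus "(if i = j then 0 else 1 / (real i ^ p * (real j ^ 2 - real i ^ 2))) =
          1 / (2 * real i ^ (p+1)) * ((if i = j then 0 else 1 / (real j - real i)) - (if i = j then 0 else 1 / (real j + real i)))"
          using i unfolding sq by auto
      qed
      also have "\<dots> = 1 / (2 * real i ^ (p+1)) * ((gen_harm 1 (N - i) - gen_harm 1 (i - 1)) - (gen_harm 1 (i + N) - gen_harm 1 i - 1 / (2 * real i)))"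
        using i by (simp only: sum_distrib_left[symmetric] sum_subtractf sum_inv_diff sum_inv_add atLeastAtMost_iff)
      also have "\<dots> = 1 / (2 * real i ^ (p+1)) * (3 / (2 * real i) - e N i)"
      proof -
        have "gen_harm 1 i = gen_harm 1 (i - 1) + 1 / real i"
          using i gen_harm_Suc[of 1 "i - 1"] by simp
        thus ?thesis by (simp add: e_def)
      qed
      finally show ?thesis using i by (simp add: field_simps)
    qed
    thus ?thesis unfolding offdiag_sum_def
      by (simp add: gen_harm_def sum_distrib_left sum_subtractf)
  qed
  show ?thesis unfolding eq
    using tendsto_diff[OF tendsto_mult_left[OF gen_harm_tendsto[of "p+2"], of "3/4"]
        tendsto_mult_left[OF harmonic_gap_sum_tendsto[of "p+1" e 2], of "1/2"]] assms e by simp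
qed

text \<open>
  For fixed \<open>i\<close>, \<open>\<Sum>j\<noteq>i. 1 / (j (j - i)) = (1/i - H_(i-1)) / i\<close> when \<open>j\<close> runs over all positive
  integers.
\<close>
lemma offdiag_sum_euler_tendsto:
  "(\<lambda>N. offdiag_sum N (\<lambda>i j. 1 / (real i ^ 6 * (real j * (real j - real i)))) + (\<Sum>i=1..N. gen_harm 1 (i - 1) / real i ^ 7)) \<longlonglongrightarrow> zeta_nat 8"
proof -
  define e where "e N i = gen_harm 1 N - gen_harm 1 (N - i)" for N i
  have e: "0 \<le> e N i \<and> e N i \<le> 1 * real i / real (Suc (N - i))" if "i \<le> N" for i N
  proof -
    have "N = (N - i) + i" using that by simp
    thus ?thesis unfolding e_def using gen_harm_gap[of "N - i" "i"] gen_harm_add[of "N - i" "i"]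
      by (auto intro!: sum_nonneg)
  qed
  have eq: "offdiag_sum N (\<lambda>i j. 1 / (real i ^ 6 * (real j * (real j - real i)))) + (\<Sum>i=1..N. gen_harm 1 (i - 1) / real i ^ 7)
      = gen_harm 8 N - (\<Sum>i=1..N. e N i / real i ^ 7)" for N
  proof -
    have "(\<Sum>j=1..N. if i = j then 0 else 1 / (real i ^ 6 * (real j * (real j - real i))))
      = 1 / real i ^ 8 - gen_harm 1 (i - 1) / real i ^ 7 - e N i / real i ^ 7" if i: "i \<in> {1..N}" for i
    proof -
      have "(\<Sum>j=1..N. if i = j then 0 else 1 / (real i ^ 6 * (real j * (real j - real i))))
         = (\<Sum>j=1..N. 1 / real i ^ 7 * ((if i = j then 0 else 1 / (real j - real i)) - (1 / real j - (if i = j then 1 / real i else 0))))"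
        using i by (intro sum.cong refl) (auto simp: field_simps eval_nat_numeral)
      also have "\<dots> = 1 / real i ^ 7 * ((gen_harm 1 (N - i) - gen_harm 1 (i - 1)) - (gen_harm 1 N - 1 / real i))"
      proof -
        have "(\<Sum>j=1..N. 1 / real j) = gen_harm 1 N" by (simp add: gen_harm_def)
        moreover have "(\<Sum>j=1..N. if i = j then 1 / real i else 0) = 1 / real i" using i by simp
        moreover have "(\<Sum>j=1..N. if i = j then 0 else 1 / (real j - real i)) = gen_harm 1 (N - i) - gen_harm 1 (i - 1)"
          using i by (intro sum_inv_diff) auto
        ultimately show ?thesis by (simp only: sum_distrib_left[symmetric] sum_subtractf)
      qed
      also have "\<dots> = 1 / real i ^ 8 - gen_harm 1 (i - 1) / real i ^ 7 - e N i / real i ^ 7"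
        using i unfolding e_def by (simp add: field_simps eval_nat_numeral)
      finally show ?thesis .
    qed
    thus ?thesis unfolding offdiag_sum_def
      by (simp add: gen_harm_def[of 8] sum_subtractf)
  qed
  show ?thesis unfolding eq
    using tendsto_diff[OF gen_harm_tendsto[of 8] harmonic_gap_sum_tendsto[of 7 e 1]] e by simp
qed

text \<open>
  With \<open>S\<close> a geometric sum, \<open>S (p - q)\<close> telescopes to two terms; the result has the shape
  \<open>g i j + g j i\<close> to which \<open>offdiag_sum_sym\<close> applies.
\<close>
lemma partial_fraction_split:
  fixes p q S a b :: real
  assumes "p \<noteq> q" "S * (p - q) = 1 / a - 1 / b"
  shows "S = 1 / (a * (p - q)) + 1 / (b * (q - p))"
proof -
  have "S = (1 / a - 1 / b) / (p - q)" using assms by (simp add: eq_divide_eq)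
  also have "\<dots> = 1 / (a * (p - q)) + 1 / - (b * (p - q))" by (simp add: diff_divide_distrib)
  also have "- (b * (p - q)) = b * (q - p)" by (simp add: algebra_simps)
  finally show ?thesis .
qed

text \<open>
  The cases \<open>k = 2, 3, 4\<close> of Euler's formula
  \<open>\<Sum>0<i<k. \<zeta>(2i) \<zeta>(2k - 2i) = (k + 1/2) \<zeta>(2k)\<close>, which lead from \<open>\<zeta>(2)\<close> to \<open>\<zeta>(8)\<close>.
\<close>
lemma zeta_nat_convolution_4: "zeta_nat 2 * zeta_nat 2 - zeta_nat 4 = 3 / 2 * zeta_nat 4"
proof (rule LIMSEQ_unique)
  show "(\<lambda>N. gen_harm 2 N * gen_harm 2 N - gen_harm 4 N) \<longlonglongrightarrow> zeta_nat 2 * zeta_nat 2 - zeta_nat 4"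
    by (intro tendsto_intros gen_harm_tendsto) auto
  have "gen_harm 2 N * gen_harm 2 N - gen_harm 4 N = 2 * offdiag_sum N (\<lambda>i j. 1 / (real i ^ 2 * (real j ^ 2 - real i ^ 2)))" for N
  proof -
    have "gen_harm 2 N * gen_harm 2 N - gen_harm 4 N = offdiag_sum N (\<lambda>i j. 1 / (real i ^ 2 * real j ^ 2))"
      using offdiag_sum_prod[of N 2 2] by simp
    also have "\<dots> = 2 * offdiag_sum N (\<lambda>i j. 1 / (real i ^ 2 * (real j ^ 2 - real i ^ 2)))"
      unfolding offdiag_sum_sym[symmetric]
      by (intro offdiag_sum_cong partial_fraction_split) (auto simp: field_simps power2_eq_iff_nonneg)
    finally show ?thesis .
  qed
  thus "(\<lambda>N. gen_harm 2 N * gen_harm 2 N - gen_harm 4 N) \<longlonglongrightarrow> 3 / 2 * zeta_nat 4"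
    using tendsto_mult_left[OF offdiag_sum_even_tendsto[of 2], of 2] by simp
qed

lemma zeta_nat_convolution_6: "2 * (zeta_nat 2 * zeta_nat 4 - zeta_nat 6) = 3 / 2 * zeta_nat 6"
proof (rule LIMSEQ_unique)
  show "(\<lambda>N. 2 * (gen_harm 2 N * gen_harm 4 N - gen_harm 6 N)) \<longlonglongrightarrow> 2 * (zeta_nat 2 * zeta_nat 4 - zeta_nat 6)"
    by (intro tendsto_intros gen_harm_tendsto) auto
  have "2 * (gen_harm 2 N * gen_harm 4 N - gen_harm 6 N) = 2 * offdiag_sum N (\<lambda>i j. 1 / (real i ^ 4 * (real j ^ 2 - real i ^ 2)))" for N
  proof -
    have "2 * (gen_harm 2 N * gen_harm 4 N - gen_harm 6 N) = offdiag_sum N (\<lambda>i j. 1 / (real i ^ 2 * real j ^ 4) + 1 / (real i ^ 4 * real j ^ 2))"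
      using offdiag_sum_prod[of N 2 4] offdiag_sum_prod[of N 4 2] by (simp add: offdiag_sum_add)
    also have "\<dots> = 2 * offdiag_sum N (\<lambda>i j. 1 / (real i ^ 4 * (real j ^ 2 - real i ^ 2)))"
      unfolding offdiag_sum_sym[symmetric]
    proof (rule offdiag_sum_cong)
      fix i j :: nat assume ij: "i \<ge> 1" "j \<ge> 1" "i \<noteq> j"
      show "1 / (real i ^ 2 * real j ^ 4) + 1 / (real i ^ 4 * real j ^ 2) =
        1 / (real i ^ 4 * (real j ^ 2 - real i ^ 2)) + 1 / (real j ^ 4 * (real i ^ 2 - real j ^ 2))"
      proof (rule partial_fraction_split)
        show "real j ^ 2 \<noteq> real i ^ 2" using ij by (simp add: power2_eq_iff_nonneg)
      qed (use ij in \<open>simp add: field_simps eval_nat_numeral\<close>)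
    qed
    finally show ?thesis .
  qed
  thus "(\<lambda>N. 2 * (gen_harm 2 N * gen_harm 4 N - gen_harm 6 N)) \<longlonglongrightarrow> 3 / 2 * zeta_nat 6"
    using tendsto_mult_left[OF offdiag_sum_even_tendsto[of 4], of 2] by simp
qed

lemma zeta_nat_convolution_8: "2 * (zeta_nat 2 * zeta_nat 6 - zeta_nat 8) + (zeta_nat 4 * zeta_nat 4 - zeta_nat 8) = 3 / 2 * zeta_nat 8"
proof (rule LIMSEQ_unique)
  show "(\<lambda>N. 2 * (gen_harm 2 N * gen_harm 6 N - gen_harm 8 N) + (gen_harm 4 N * gen_harm 4 N - gen_harm 8 N))
     \<longlonglongrightarrow> 2 * (zeta_nat 2 * zeta_nat 6 - zeta_nat 8) + (zeta_nat 4 * zeta_nat 4 - zeta_nat 8)"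
    by (intro tendsto_intros gen_harm_tendsto) auto
  have "2 * (gen_harm 2 N * gen_harm 6 N - gen_harm 8 N) + (gen_harm 4 N * gen_harm 4 N - gen_harm 8 N)
     = 2 * offdiag_sum N (\<lambda>i j. 1 / (real i ^ 6 * (real j ^ 2 - real i ^ 2)))" for N
  proof -
    have "2 * (gen_harm 2 N * gen_harm 6 N - gen_harm 8 N) + (gen_harm 4 N * gen_harm 4 N - gen_harm 8 N)
      = offdiag_sum N (\<lambda>i j. 1 / (real i ^ 2 * real j ^ 6) + 1 / (real i ^ 4 * real j ^ 4) + 1 / (real i ^ 6 * real j ^ 2))"
      using offdiag_sum_prod[of N 2 6] offdiag_sum_prod[of N 4 4] offdiag_sum_prod[of N 6 2] by (simp add: offdiag_sum_add)
    also have "\<dots> = 2 * offdiag_sum N (\<lambda>i j. 1 / (real i ^ 6 * (real j ^ 2 - real i ^ 2)))"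
      unfolding offdiag_sum_sym[symmetric]
    proof (rule offdiag_sum_cong)
      fix i j :: nat assume ij: "i \<ge> 1" "j \<ge> 1" "i \<noteq> j"
      show "1 / (real i ^ 2 * real j ^ 6) + 1 / (real i ^ 4 * real j ^ 4) + 1 / (real i ^ 6 * real j ^ 2) =
        1 / (real i ^ 6 * (real j ^ 2 - real i ^ 2)) + 1 / (real j ^ 6 * (real i ^ 2 - real j ^ 2))"
      proof (rule partial_fraction_split)
        show "real j ^ 2 \<noteq> real i ^ 2" using ij by (simp add: power2_eq_iff_nonneg)
      qed (use ij in \<open>simp add: field_simps eval_nat_numeral\<close>)
    qed
    finally show ?thesis .
  qed
  thus "(\<lambda>N. 2 * (gen_harm 2 N * gen_harm 6 N - gen_harm 8 N) + (gen_harm 4 N * gen_harm 4 N - gen_harm 8 N)) \<longlonglongrightarrow> 3 / 2 * zeta_nat 8"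
    using tendsto_mult_left[OF offdiag_sum_even_tendsto[of 6], of 2] by simp
qed

lemma zeta_nat_8: "zeta_nat 8 = pi ^ 8 / 9450"
proof -
  have 2: "zeta_nat 2 = pi^2 / 6"
    by (rule sums_unique2[OF zeta_nat_sums]) (use inverse_squares_sums in \<open>simp_all add: add.commute\<close>)
  have 4: "zeta_nat 4 = pi^4 / 90" using zeta_nat_convolution_4 unfolding 2 by (simp add: field_simps eval_nat_numeral)
  have 6: "zeta_nat 6 = pi^6 / 945" using zeta_nat_convolution_6 unfolding 2 4 by (simp add: field_simps eval_nat_numeral)
  show ?thesis using zeta_nat_convolution_8 unfolding 2 4 6 by (simp add: field_simps eval_nat_numeral)
qed

text \<open>
  Summing \<open>i^(-k) j^(k-8)\<close> over \<open>k = 2, ..., 6\<close> off the diagonal gives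
  \<open>2 \<zeta>(2) \<zeta>(6) + 2 \<zeta>(3) \<zeta>(5) + \<zeta>(4)^2 - 5 \<zeta>(8) = 2 \<zeta>(8) - 2 \<zeta>(7,1)\<close>; the products of even
  zeta values are then eliminated by \<open>zeta_nat_convolution_8\<close>.
\<close>
lemma euler_double_sum_7_1: "(\<lambda>N. \<Sum>i=1..N. gen_harm 1 (i - 1) / real i ^ 7) \<longlonglongrightarrow> 5 / 4 * zeta_nat 8 - zeta_nat 3 * zeta_nat 5"
proof -
  define P where "P N = gen_harm 2 N * gen_harm 6 N + gen_harm 3 N * gen_harm 5 N + gen_harm 4 N * gen_harm 4 N / 2 - 5 / 2 * gen_harm 8 N" for N
  have *: "offdiag_sum N (\<lambda>i j. 1 / (real i ^ 6 * (real j * (real j - real i)))) = P N" for N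
  proof -
    have "2 * P N = offdiag_sum N (\<lambda>i j. 1 / (real i ^ 2 * real j ^ 6) + 1 / (real i ^ 3 * real j ^ 5) + 1 / (real i ^ 4 * real j ^ 4)
       + 1 / (real i ^ 5 * real j ^ 3) + 1 / (real i ^ 6 * real j ^ 2))"
      using offdiag_sum_prod[of N 2 6] offdiag_sum_prod[of N 3 5] offdiag_sum_prod[of N 4 4] offdiag_sum_prod[of N 5 3] offdiag_sum_prod[of N 6 2]
      by (simp add: offdiag_sum_add P_def)
    also have "\<dots> = 2 * offdiag_sum N (\<lambda>i j. 1 / (real i ^ 6 * (real j * (real j - real i))))"
      unfolding offdiag_sum_sym[symmetric]
    proof (rule offdiag_sum_cong)
      fix i j :: nat assume ij: "i \<ge> 1" "j \<ge> 1" "i \<noteq> j"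
      show "1 / (real i ^ 2 * real j ^ 6) + 1 / (real i ^ 3 * real j ^ 5) + 1 / (real i ^ 4 * real j ^ 4)
       + 1 / (real i ^ 5 * real j ^ 3) + 1 / (real i ^ 6 * real j ^ 2) =
        1 / (real i ^ 6 * (real j * (real j - real i))) + 1 / (real j ^ 6 * (real i * (real i - real j)))"
        unfolding mult.assoc[symmetric] using ij by (intro partial_fraction_split) (auto simp: field_simps eval_nat_numeral)
    qed
    finally show ?thesis by simp
  qed
  have "P \<longlonglongrightarrow> zeta_nat 2 * zeta_nat 6 + zeta_nat 3 * zeta_nat 5 + zeta_nat 4 * zeta_nat 4 / 2 - 5 / 2 * zeta_nat 8"
    unfolding P_def by (intro tendsto_intros gen_harm_tendsto) auto
  from tendsto_diff[OF offdiag_sum_euler_tendsto this]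
  have "(\<lambda>N. \<Sum>i=1..N. gen_harm 1 (i - 1) / real i ^ 7) \<longlonglongrightarrow> zeta_nat 8 - (zeta_nat 2 * zeta_nat 6 + zeta_nat 3 * zeta_nat 5 + zeta_nat 4 * zeta_nat 4 / 2 - 5 / 2 * zeta_nat 8)"
    unfolding * by simp
  also have "zeta_nat 8 - (zeta_nat 2 * zeta_nat 6 + zeta_nat 3 * zeta_nat 5 + zeta_nat 4 * zeta_nat 4 / 2 - 5 / 2 * zeta_nat 8) = 5 / 4 * zeta_nat 8 - zeta_nat 3 * zeta_nat 5"
    using zeta_nat_convolution_8 by simp
  finally show ?thesis .
qed

lemma gen_harm_stuffle:
  "gen_harm a N * gen_harm b N = gen_harm (a + b) N + (\<Sum>k<N. gen_harm a k / real (Suc k) ^ b) + (\<Sum>k<N. gen_harm b k / real (Suc k) ^ a)"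
  by (induction N) (simp_all add: gen_harm_Suc algebra_simps power_add del: of_nat_Suc)

section \<open>The multiple zeta value and the theorem\<close>
lemma mzv_53_sums: "(\<lambda>k. gen_harm 3 k / real (Suc k) ^ 5) sums mzv [5, 3]"
proof -
  define f where "f = (\<lambda>(a, b). 1 / real a ^ 5 * (1 / real b ^ 3))"
  define g where "g a = gen_harm 3 (a - 1) / real a ^ 5" for a
  have "summable (\<lambda>k. gen_harm 3 k / real (Suc k) ^ 5)"
  proof (rule summable_comparison_test')
    show "summable (\<lambda>k. 2 * (1 / real (Suc k) ^ 5))"
      using zeta_nat_sums[of 5] by (intro summable_mult) (auto simp: sums_iff)
    show "norm (gen_harm 3 k / real (Suc k) ^ 5) \<le> 2 * (1 / real (Suc k) ^ 5)" for k
      using gen_harm_le_2[of 3 k] by (simp add: divide_right_mono del: of_nat_Suc)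
  qed
  then obtain S where S: "(\<lambda>k. gen_harm 3 k / real (Suc k) ^ 5) sums S" by (auto simp: summable_def)
  hence "((\<lambda>k. g (Suc k)) has_sum S) UNIV"
    unfolding g_def by (intro sums_nonneg_imp_has_sum) (auto simp del: of_nat_Suc)
  hence g: "(g has_sum S) {1..}"
    by (subst has_sum_reindex_bij_betw[of Suc UNIV "{1..}" g, symmetric])
       (auto simp: bij_betw_def image_iff gr0_conv_Suc Suc_le_eq)
  have inner: "((\<lambda>b. f (a, b)) has_sum g a) {1..<a}" if "a \<in> {1..}" for a
  proof -
    have "{1..<a} = {1..a-1}" by auto
    hence "(\<Sum>b\<in>{1..<a}. f (a, b)) = g a" by (simp add: f_def g_def gen_harm_def sum_divide_distrib mult_ac)
    thus ?thesis using has_sum_finite[of "{1..<a}" "\<lambda>b. f (a, b)"] by simp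
  qed
  have "f summable_on Sigma {1..} (\<lambda>a. {1..<a})"
    by (rule summable_on_SigmaI[OF inner]) (use g in \<open>auto simp: f_def summable_on_def\<close>)
  hence "(f has_sum S) (Sigma {1..} (\<lambda>a. {1..<a}))"
    by (intro has_sum_SigmaI[OF inner g])
  hence "infsum f (Sigma {1..} (\<lambda>a. {1..<a})) = S" by (rule infsumI)
  also have "infsum f (Sigma {1..} (\<lambda>a. {1..<a})) = mzv [5, 3]"
    unfolding mzv_def
    by (rule infsum_reindex_bij_witness[where i="\<lambda>ns. (ns ! 0, ns ! 1)" and j="\<lambda>(a, b). [a, b]"])
       (auto simp: f_def length_Suc_conv numeral_2_eq_2 lessThan_Suc)
  finally show ?thesis using S by simp
qed

lemma wz_F_0_sums: "(\<lambda>n. ctf (wz_F 0 (n + 1))) sums (- 2 * mzv [5, 3] - zeta_nat 8)"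
proof -
  have A: "(\<lambda>N. \<Sum>k<N. gen_harm 3 k / real (Suc k) ^ 5) \<longlonglongrightarrow> mzv [5, 3]"
    using mzv_53_sums by (simp add: sums_def)
  have "(\<lambda>N. gen_harm 3 N * gen_harm 5 N - gen_harm 8 N - (\<Sum>k<N. gen_harm 3 k / real (Suc k) ^ 5)) \<longlonglongrightarrow> zeta_nat 3 * zeta_nat 5 - zeta_nat 8 - mzv [5,3]"
    by (intro tendsto_intros gen_harm_tendsto A) auto
  hence B: "(\<lambda>k. gen_harm 5 k / real (Suc k) ^ 3) sums (zeta_nat 3 * zeta_nat 5 - zeta_nat 8 - mzv [5,3])"
    unfolding sums_def using gen_harm_stuffle[of 3 _ 5] by (simp add: algebra_simps)
  have C: "(\<lambda>k. gen_harm 1 k / real (Suc k) ^ 7) sums (5 / 4 * zeta_nat 8 - zeta_nat 3 * zeta_nat 5)"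
  proof -
    have "(\<Sum>i=1..N. gen_harm 1 (i - 1) / real i ^ 7) = (\<Sum>k<N. gen_harm 1 k / real (Suc k) ^ 7)" for N
      by (induction N) auto
    thus ?thesis using euler_double_sum_7_1 by (simp add: sums_def)
  qed
  have "(\<lambda>k. 2 * (gen_harm 5 k / real (Suc k) ^ 3) + 2 * (gen_harm 1 k / real (Suc k) ^ 7) - 3 / 2 * (1 / real (Suc k) ^ 8))
    sums (2 * (zeta_nat 3 * zeta_nat 5 - zeta_nat 8 - mzv [5,3]) + 2 * (5 / 4 * zeta_nat 8 - zeta_nat 3 * zeta_nat 5) - 3 / 2 * zeta_nat 8)"
    by (intro sums_add sums_diff sums_mult B C zeta_nat_sums) auto
  moreover have "2 * (zeta_nat 3 * zeta_nat 5 - zeta_nat 8 - mzv [5,3]) + 2 * (5 / 4 * zeta_nat 8 - zeta_nat 3 * zeta_nat 5) - 3 / 2 * zeta_nat 8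
    = - 2 * mzv [5, 3] - zeta_nat 8" by (simp add: field_simps)
  ultimately show ?thesis by (simp only: ctf_wz_F_0 Let_def Suc_eq_plus1[symmetric]) simp
qed

theorem mainTheorem2:
  shows "(\<lambda>k. let n = Suc k; x = real n in
            (- 1 / 2 ^ 10) ^ n * (pochhammer 1 n ^ 5 / pochhammer (1 / 2) n ^ 5)
            * ((351 - 1755 * x + 2240 * x ^ 2) / x ^ 10
               - (11 * gen_harm 5 n - gen_harm 5 (2 * n)) * (205 * x ^ 2 - 160 * x + 32) / x ^ 5))
         sums (- 4 * mzv [5, 3] - pi ^ 8 / 4725)"
proof -
  have "(\<lambda>k. 2 * ctf (wz_step k)) sums (2 * (- 2 * mzv [5, 3] - zeta_nat 8))"
    using wz_step_sums wz_F_0_sums by (intro sums_mult) (simp add: sums_iff)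
  moreover have "2 * ctf (wz_step k) = (let n = Suc k; x = real n in
            (- 1 / 2 ^ 10) ^ n * (pochhammer 1 n ^ 5 / pochhammer (1 / 2) n ^ 5)
            * ((351 - 1755 * x + 2240 * x ^ 2) / x ^ 10
               - (11 * gen_harm 5 n - gen_harm 5 (2 * n)) * (205 * x ^ 2 - 160 * x + 32) / x ^ 5))" for k
  proof -
    define x where "x = real (Suc k)"
    have x: "x > 0" by (simp add: x_def)
    define p where "p = pochhammer (1/2::real) (Suc k)"
    have p: "p \<noteq> 0" unfolding p_def by (simp add: pochhammer_eq_0_iff)
    have f1: "fact (Suc k) = x * fact k" by (simp add: x_def)
    have f2: "fact (2*k+2) = 2 ^ (2 * Suc k) * p * (x * fact k)"
      using fact_double[of "Suc k", where 'a=real] unfolding p_def f1 by simp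
    define Y where "Y = (- 1 / 2 ^ 10) ^ Suc k * (fact (Suc k) ^ 5 / p ^ 5)"
    have Y: "(-1)^k * (fact k ^ 10 / fact (2*k+2) ^ 5) = - Y / x ^ 10"
    proof -
      have e: "((2::real) ^ (2 * Suc k)) ^ 5 = (2 ^ 10) ^ Suc k" 
      proof -
        have "2 * Suc k * 5 = 10 * Suc k" by simp
        thus ?thesis by (metis power_mult)
      qed
      have m: "(- 1 / 2 ^ 10 :: real) ^ Suc k = - ((-1) ^ k) / (2^10) ^ Suc k" by (subst power_divide) simp
      show ?thesis unfolding Y_def f2 f1 power_mult_distrib e m using x p by (simp add: field_simps eval_nat_numeral)
    qed
    have H: "gen_harm 5 (Suc k) = gen_harm 5 k + 1 / x ^ 5" by (simp add: gen_harm_Suc x_def)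
    have "2 * ctf (wz_step k) = 2 * (- Y / x ^ 10 * ((15*x^2-5*x+1)/2 +
      (11 * gen_harm 5 k - gen_harm 5 (2 * Suc k)) * (x^5 * (205*x^2-160*x+32) / 2)))"
      unfolding ctf_wz_step Y by (simp add: x_def)
    also have "\<dots> = Y * ((351 - 1755 * x + 2240 * x ^ 2) / x ^ 10
      - (11 * gen_harm 5 (Suc k) - gen_harm 5 (2 * Suc k)) * (205 * x ^ 2 - 160 * x + 32) / x ^ 5)"
      unfolding H using x by (simp add: field_simps)
    finally show ?thesis
      unfolding Let_def x_def[symmetric] p_def[symmetric] pochhammer_fact[symmetric] Y_def .
  qed
  ultimately show ?thesis by (simp add: zeta_nat_8)
qed
end
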